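(* Let $\varphi_1>1$ and let $f \in C[\varphi_1,\infty)$ be a real-valued function with $\lim_{\varphi\to\infty} f(\varphi)=0$. Assume that there exist positive constants $\overline{m}$ and $M$ such that, for all $\varphi \ge \varphi_1$, $$0 < f(\varphi) \le \overline{m}\, \varphi^{-1},$$ $$0 < f(\varphi) - f(\varphi+2\pi),$$ $$\mathrm{length}(\Gamma(\varphi_1,\varphi)) \le M \log \varphi.$$ Let $\Gamma= \{ (f(\varphi)\cos \varphi,f(\varphi)\sin \varphi) : \varphi \ge \varphi_1 \}$. Then $\dim_{\rm B} \Gamma = 1$.
   Context: For $\psi_1<\psi_2$, $\Gamma(\psi_1,\psi_2) = \{ (f(\varphi)\cos\varphi,f(\varphi)\sin\varphi) : \psi_1 \le \varphi < \psi_2 \}$, and $\mathrm{length}$ denotes the usual length of a curve (supremum of lengths of inscribed polygonal lines). For a bounded set $\Gamma\subset\mathbf{R}^2$, the box-counting (Minkowski-Bouligand) dimension is $$\dim_{\rm B} \Gamma = 2 - \lim_{\varepsilon \to +0} \frac{\log|\Gamma_\varepsilon|}{\log \varepsilon},$$ where $\Gamma_\varepsilon = \{ (x,y) \in \mathbf{R}^2 : d((x,y),\Gamma) \le \varepsilon \}$, $d$ is the Euclidean distance, and $|\Gamma_\varepsilon|$ is the two-dimensional Lebesgue measure of $\Gamma_\varepsilon$. The assertion $\dim_{\rm B}\Gamma=d$ includes that the limit exists. *)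

theory Defs
  imports "HOL-Analysis.Analysis"
begin

text \<open>The plane is \<^typ>\<open>real \<times> real\<close>, whose product metric is the Euclidean one.\<close>

definition polar_curve :: "(real \<Rightarrow> real) \<Rightarrow> real \<Rightarrow> real \<times> real" where
  "polar_curve f \<phi> = (f \<phi> * cos \<phi>, f \<phi> * sin \<phi>)"

text \<open>
  Length of the curve \<open>\<gamma>\<close> with parameter set \<open>S\<close>: the supremum of the lengths of the inscribed
  polygonal lines, given by the lists of their parameters in increasing order. The value is
  infinite if the curve is not rectifiable. \<open>S\<close> need not be closed, so that half-open arcs are
  covered.
\<close>

definition polyline_length :: "'a::metric_space list \<Rightarrow> real" where
  "polyline_length ps = (\<Sum>i<length ps - 1. dist (ps ! i) (ps ! Suc i))"

definition curve_length :: "(real \<Rightarrow> 'a::metric_space) \<Rightarrow> real set \<Rightarrow> ennreal" where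
  "curve_length \<gamma> S = (SUP ts\<in>{ts. sorted ts \<and> set ts \<subseteq> S}. ennreal (polyline_length (map \<gamma> ts)))"

definition parallel_set :: "(real \<times> real) set \<Rightarrow> real \<Rightarrow> (real \<times> real) set" where
  "parallel_set G \<epsilon> = {p. infdist p G \<le> \<epsilon>}"

text \<open>
  The assertion that the box-counting (Minkowski--Bouligand) dimension of \<open>G\<close> exists and equals
  \<open>d\<close>. The notion is for bounded sets; the empty set is excluded because of the convention
  \<open>infdist p {} = 0\<close>.
\<close>

definition has_box_dim :: "(real \<times> real) set \<Rightarrow> real \<Rightarrow> bool" where
  "has_box_dim G d \<longleftrightarrow> bounded G \<and> G \<noteq> {} \<and>
     (\<exists>L. ((\<lambda>\<epsilon>. ln (measure lebesgue (parallel_set G \<epsilon>)) / ln \<epsilon>) \<longlongrightarrow> L) (at_right 0) \<and> d = 2 - L)"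

end

theory Submission
  imports Defs "HOL-Real_Asymp.Real_Asymp"
begin

text \<open>
  Cut the spiral at the angle \<open>1/\<epsilon>\<close>. By the decay of \<open>f\<close> the tail lies within \<open>O(\<epsilon>)\<close> of the
  origin, and the rest has length \<open>O(ln (1/\<epsilon>))\<close>, so it is covered by \<open>O(ln (1/\<epsilon>) / \<epsilon>)\<close> discs of
  radius \<open>\<epsilon>\<close>. Hence the \<open>\<epsilon>\<close>-neighbourhood has area \<open>O(\<epsilon> ln (1/\<epsilon>))\<close>. Conversely, the spiral is
  connected and not a single point, so the area is at least of order \<open>\<epsilon>\<close>.
\<close>

text \<open>Since \<open>ennreal\<close> sends negative reals to 0, the bound can be pulled back to
  the reals only for nonnegative \<open>L\<close>.\<close>

lemma polyline_length_le:
  assumes "curve_length \<gamma> S \<le> ennreal L" "0 \<le> L" "sorted ts" "set ts \<subseteq> S"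
  shows "polyline_length (map \<gamma> ts) \<le> L"
proof -
  have "ennreal (polyline_length (map \<gamma> ts)) \<le> curve_length \<gamma> S"
    unfolding curve_length_def using assms(3,4) by (intro SUP_upper) auto
  then show ?thesis
    using assms(1,2) by (meson ennreal_le_iff order_trans)
qed

text \<open>Listing \<open>T\<close> in increasing order gives an inscribed polygonal line with
  \<open>card T - 1\<close> edges, each longer than \<open>\<epsilon>\<close>; the summand 1
  accounts for having one more vertex than edges.\<close>

lemma card_separated_le:
  fixes \<gamma> :: "real \<Rightarrow> 'a::metric_space"
  assumes "curve_length \<gamma> S \<le> ennreal L" "0 \<le> L" "0 < \<epsilon>"
    and "finite T" "T \<subseteq> S" "pairwise (\<lambda>s t. \<epsilon> < dist (\<gamma> s) (\<gamma> t)) T"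
  shows "real (card T) \<le> L / \<epsilon> + 1"
proof -
  define ts where "ts = sorted_list_of_set T"
  have ts: "sorted ts" "set ts = T" "distinct ts" "length ts = card T"
    using assms(4) by (auto simp: ts_def)
  have "\<epsilon> \<le> dist (map \<gamma> ts ! i) (map \<gamma> ts ! Suc i)" if "i < card T - 1" for i
  proof -
    have i: "i < length ts" "Suc i < length ts" using that ts(4) by auto
    then have "ts ! i \<noteq> ts ! Suc i" using ts(3) by (simp add: nth_eq_iff_index_eq)
    moreover have "ts ! i \<in> T" "ts ! Suc i \<in> T" using i ts(2) nth_mem by blast+
    ultimately have "\<epsilon> < dist (\<gamma> (ts ! i)) (\<gamma> (ts ! Suc i))"
      using assms(6) by (simp add: pairwise_def)
    then show ?thesis using i by simp
  qed
  then have "of_nat (card {..<card T - 1}) * \<epsilon> \<le> polyline_length (map \<gamma> ts)"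
    unfolding polyline_length_def length_map ts(4) by (intro sum_bounded_below) auto
  also have "\<dots> \<le> L"
    using polyline_length_le[OF assms(1,2)] ts assms(5) by auto
  \<comment> \<open>The subtraction is truncated, but \<open>card T\<close> is at most
    \<open>(card T - 1) + 1\<close> also for empty \<open>T\<close>.\<close>
  finally have "real (card T - 1) \<le> L / \<epsilon>"
    using assms(3) by (simp add: field_simps)
  then show ?thesis by simp
qed

text \<open>A separated set of maximal cardinality is a net: a point farther than
  \<open>\<epsilon>\<close> from all its points could be added. The maximum exists because
  \<open>card_separated_le\<close> bounds all cardinalities.\<close>

lemma curve_length_net:
  fixes \<gamma> :: "real \<Rightarrow> 'a::metric_space"
  assumes "curve_length \<gamma> S \<le> ennreal L" "0 \<le> L" "0 < \<epsilon>"
  obtains T where "finite T" "T \<subseteq> S" "real (card T) \<le> L / \<epsilon> + 1"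
    "\<And>s. s \<in> S \<Longrightarrow> \<exists>t\<in>T. dist (\<gamma> s) (\<gamma> t) \<le> \<epsilon>"
proof -
  define P where "P T \<longleftrightarrow> finite T \<and> T \<subseteq> S \<and> pairwise (\<lambda>s t. \<epsilon> < dist (\<gamma> s) (\<gamma> t)) T" for T
  have bound: "real (card T) \<le> L / \<epsilon> + 1" if "P T" for T
    using that card_separated_le[OF assms] by (auto simp: P_def)
  have "card T < Suc (nat \<lfloor>L / \<epsilon> + 1\<rfloor>)" if "P T" for T
    using bound[OF that] by (simp only: less_Suc_eq_le le_nat_floor)
  moreover have "P {}" by (simp add: P_def)
  ultimately obtain T where T: "P T" and max: "\<And>T'. P T' \<Longrightarrow> card T' \<le> card T"
    using ex_has_greatest_nat[of P "{}" card "Suc (nat \<lfloor>L / \<epsilon> + 1\<rfloor>)"] by metis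
  have "\<exists>t\<in>T. dist (\<gamma> s) (\<gamma> t) \<le> \<epsilon>" if "s \<in> S" for s
  proof (rule ccontr)
    assume far: "\<not> ?thesis"
    then have "s \<notin> T" using assms(3) by (metis dist_self less_imp_le)
    moreover from far have "P (insert s T)"
      using T that by (auto simp: P_def pairwise_insert dist_commute not_le)
    ultimately show False
      using max[of "insert s T"] T by (simp add: P_def)
  qed
  then show thesis
    using that T bound[OF T] by (auto simp: P_def)
qed

lemma parallel_set_lmeasurable:
  assumes "bounded G" "G \<noteq> {}"
  shows "parallel_set G \<epsilon> \<in> lmeasurable"
proof -
  obtain a B where B: "\<And>q. q \<in> G \<Longrightarrow> dist a q \<le> B"
    using assms(1) by (auto simp: bounded_def)
  have "parallel_set G \<epsilon> \<subseteq> cball a (\<epsilon> + 1 + B)"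
  proof
    fix p assume "p \<in> parallel_set G \<epsilon>"
    \<comment> \<open>\<open>G\<close> need not be closed, so the infimum may not be attained; the
      slack 1 yields an actual point of \<open>G\<close>.\<close>
    then have "infdist p G < \<epsilon> + 1" by (simp add: parallel_set_def)
    then obtain q where "q \<in> G" "dist p q < \<epsilon> + 1"
      using assms(2) by (auto simp: infdist_def cINF_less_iff)
    then show "p \<in> cball a (\<epsilon> + 1 + B)"
      using B[of q] dist_triangle[of a p q] by (simp add: dist_commute)
  qed
  then have "bounded (parallel_set G \<epsilon>)" using bounded_cball bounded_subset by blast
  moreover have "closed (parallel_set G \<epsilon>)"
    unfolding parallel_set_def by (intro closed_Collect_le continuous_intros)
  ultimately show ?thesis
    by (simp add: lmeasurable_compact compact_eq_bounded_closed)
qed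

lemma measure_ball_plane:
  "0 \<le> r \<Longrightarrow> measure lebesgue (ball (p :: real \<times> real) r) = pi * r\<^sup>2"
  "0 \<le> r \<Longrightarrow> measure lebesgue (cball (p :: real \<times> real) r) = pi * r\<^sup>2"
  by (simp_all add: content_ball content_cball unit_ball_vol_2 power2_eq_square)

text \<open>By connectedness the distance from \<open>p\<close> takes every value in
  \<open>[0, dist p q]\<close> on \<open>G\<close>. Points of \<open>G\<close> at distances 0,
  \<open>2 * \<epsilon>\<close>, \<open>4 * \<epsilon>\<close>, ... from \<open>p\<close> are
  centres of disjoint discs of radius \<open>\<epsilon>\<close> inside the parallel set.\<close>

lemma connected_parallel_set_ge:
  assumes "connected G" "bounded G" "p \<in> G" "q \<in> G" "0 < \<epsilon>"
  shows "dist p q * pi / 2 * \<epsilon> \<le> measure lebesgue (parallel_set G \<epsilon>)"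
proof -
  \<comment> \<open>The number of multiples of \<open>2 * \<epsilon>\<close> in
    \<open>[0, dist p q]\<close>, with 0 included, hence at least
    \<open>dist p q / (2 * \<epsilon>)\<close>.\<close>
  define N where "N = Suc (nat \<lfloor>dist p q / (2 * \<epsilon>)\<rfloor>)"
  have "\<exists>c\<in>G. dist p c = 2 * \<epsilon> * real k" if "k < N" for k
  proof -
    have "real k \<le> dist p q / (2 * \<epsilon>)"
      using that assms(5) by (simp add: N_def less_Suc_eq_le le_floor_iff le_nat_iff)
    then have "2 * \<epsilon> * real k \<le> dist p q"
      using assms(5) by (simp add: field_simps)
    moreover have "connected (dist p ` G)"
      by (intro connected_continuous_image continuous_intros assms)
    moreover have "dist p p \<in> dist p ` G" "dist p q \<in> dist p ` G"
      using assms by blast+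
    ultimately have "2 * \<epsilon> * real k \<in> dist p ` G"
      using connectedD_interval[of "dist p ` G" "dist p p" "dist p q"] assms(5) by auto
    then show ?thesis by force
  qed
  then obtain c where c: "\<And>k. k < N \<Longrightarrow> c k \<in> G" "\<And>k. k < N \<Longrightarrow> dist p (c k) = 2 * \<epsilon> * real k"
    by metis
  have disj: "disjnt (ball (c j) \<epsilon>) (ball (c k) \<epsilon>)" if "j < N" "k < N" "j \<noteq> k" for j k
  proof -
    \<comment> \<open>Centres exactly \<open>2 * \<epsilon>\<close> apart are far enough, because
      the balls are open.\<close>
    have "2 * \<epsilon> * 1 \<le> 2 * \<epsilon> * \<bar>real j - real k\<bar>"
      using that(3) assms(5) by (intro mult_left_mono) auto
    also have "\<dots> = \<bar>dist p (c j) - dist p (c k)\<bar>"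
      using c that(1,2) assms(5) by (simp add: abs_mult flip: right_diff_distrib)
    also have "\<dots> \<le> dist (c j) (c k)"
      by (metis abs_dist_diff_le dist_commute)
    finally show ?thesis
      by (simp add: disjnt_def disjoint_ballI)
  qed
  have sub: "(\<Union>k<N. ball (c k) \<epsilon>) \<subseteq> parallel_set G \<epsilon>"
    using c(1) by (force simp: parallel_set_def dist_commute intro: infdist_le2)
  have "dist p q / (2 * \<epsilon>) \<le> real N"
    unfolding N_def by linarith
  then have "dist p q / (2 * \<epsilon>) * (pi * \<epsilon>\<^sup>2) \<le> real N * (pi * \<epsilon>\<^sup>2)"
    by (intro mult_right_mono) auto
  also have "\<dots> = (\<Sum>k<N. measure lebesgue (ball (c k) \<epsilon>))"
    by (simp only: measure_ball_plane(1)[OF less_imp_le[OF assms(5)]] sum_constant card_lessThan)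
  also have "\<dots> = measure lebesgue (\<Union>k<N. ball (c k) \<epsilon>)"
    using disj by (intro measure_UNION'[symmetric]) (auto simp: pairwise_def)
  also have "\<dots> \<le> measure lebesgue (parallel_set G \<epsilon>)"
    using assms(2,3) sub by (intro measure_mono_fmeasurable parallel_set_lmeasurable) auto
  finally show ?thesis
    using assms(5) by (simp add: field_simps power2_eq_square)
qed

lemma measure_finite_UN_cball_le:
  fixes c :: "'i \<Rightarrow> real \<times> real"
  assumes "finite I" "0 \<le> r"
  shows "measure lebesgue (\<Union>i\<in>I. cball (c i) r) \<le> real (card I) * (pi * r\<^sup>2)"
proof -
  have "measure lebesgue (\<Union>i\<in>I. cball (c i) r) \<le> (\<Sum>i\<in>I. measure lebesgue (cball (c i) r))"
    using assms(1) by (intro measure_UNION_le) auto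
  then show ?thesis by (simp only: measure_ball_plane(2)[OF assms(2)] sum_constant)
qed

lemma norm_polar_curve: "norm (polar_curve f \<phi>) = \<bar>f \<phi>\<bar>"
proof -
  have "(f \<phi> * cos \<phi>)\<^sup>2 + (f \<phi> * sin \<phi>)\<^sup>2 = (f \<phi>)\<^sup>2 * ((cos \<phi>)\<^sup>2 + (sin \<phi>)\<^sup>2)"
    by (simp only: power_mult_distrib distrib_left)
  then show ?thesis by (simp add: polar_curve_def norm_Pair)
qed

text \<open>Discs of radius \<open>3 * \<epsilon>\<close> about the net cover what is near the arc
  before angle \<open>1 / \<epsilon>\<close>: \<open>2 * \<epsilon>\<close> to reach the curve and
  \<open>\<epsilon>\<close> to reach the net. On the tail the radius is at most
  \<open>m * \<epsilon>\<close>, so one disc of radius \<open>(m + 2) * \<epsilon>\<close> about the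
  origin covers the rest.\<close>

lemma spiral_parallel_set_le:
  assumes f: "\<And>\<phi>. \<phi> \<ge> \<phi>\<^sub>1 \<Longrightarrow> \<bar>f \<phi>\<bar> \<le> m * inverse \<phi>" and "0 < \<phi>\<^sub>1" "0 < m"
    and len: "curve_length (polar_curve f) {\<phi>\<^sub>1..<1 / \<epsilon>} \<le> ennreal L" and "0 \<le> L"
    and \<epsilon>: "0 < \<epsilon>" and bdd: "bounded (polar_curve f ` {\<phi>\<^sub>1..})"
  shows "measure lebesgue (parallel_set (polar_curve f ` {\<phi>\<^sub>1..}) \<epsilon>)
    \<le> (L / \<epsilon> + 1) * (pi * (3 * \<epsilon>)\<^sup>2) + pi * ((m + 2) * \<epsilon>)\<^sup>2"
proof -
  let ?G = "polar_curve f ` {\<phi>\<^sub>1..}"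
  obtain T where T: "finite T" "real (card T) \<le> L / \<epsilon> + 1"
    and net: "\<And>s. s \<in> {\<phi>\<^sub>1..<1 / \<epsilon>} \<Longrightarrow> \<exists>t\<in>T. dist (polar_curve f s) (polar_curve f t) \<le> \<epsilon>"
    using curve_length_net[OF len \<open>0 \<le> L\<close> \<epsilon>] by metis
  let ?A = "\<Union>t\<in>T. cball (polar_curve f t) (3 * \<epsilon>)" and ?B = "cball (0 :: real \<times> real) ((m + 2) * \<epsilon>)"
  have A: "?A \<in> lmeasurable" using T(1) by (intro fmeasurable.finite_UN) auto
  have "parallel_set ?G \<epsilon> \<subseteq> ?A \<union> ?B"
  proof
    fix p assume "p \<in> parallel_set ?G \<epsilon>"
    \<comment> \<open>Doubling \<open>\<epsilon>\<close> makes the inequality strict, so that a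
      point of the curve itself realises it.\<close>
    then have "infdist p ?G < 2 * \<epsilon>" using \<epsilon> by (simp add: parallel_set_def)
    then have "\<exists>q\<in>?G. dist p q < 2 * \<epsilon>"
      by (subst (asm) infdist_notempty) (auto simp: cINF_less_iff)
    then obtain s where s: "s \<ge> \<phi>\<^sub>1" "dist p (polar_curve f s) < 2 * \<epsilon>" by auto
    show "p \<in> ?A \<union> ?B"
    proof (cases "s < 1 / \<epsilon>")
      case True
      then obtain t where "t \<in> T" "dist (polar_curve f s) (polar_curve f t) \<le> \<epsilon>"
        using net s(1) by force
      moreover from this have "dist (polar_curve f t) p \<le> 3 * \<epsilon>"
        using s(2) dist_triangle[of p "polar_curve f t" "polar_curve f s"] by (simp add: dist_commute)
      ultimately show ?thesis by auto
    next
      case False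
      then have "inverse s \<le> \<epsilon>" using \<epsilon> assms(2) s(1) by (simp add: field_simps)
      then have "\<bar>f s\<bar> \<le> m * \<epsilon>"
        using f[OF s(1)] \<open>0 < m\<close> by (meson mult_left_mono less_imp_le order_trans)
      then have "norm p \<le> (m + 2) * \<epsilon>"
        using s(2) norm_triangle_sub[of p "polar_curve f s"]
        by (simp add: dist_norm norm_polar_curve algebra_simps)
      then show ?thesis by simp
    qed
  qed
  then have "measure lebesgue (parallel_set ?G \<epsilon>) \<le> measure lebesgue (?A \<union> ?B)"
    using A bdd by (intro measure_mono_fmeasurable fmeasurable.Un fmeasurableD
        parallel_set_lmeasurable) auto
  also have "\<dots> \<le> measure lebesgue ?A + measure lebesgue ?B"
    using A by (intro measure_Un_le) auto
  also have "measure lebesgue ?A \<le> (L / \<epsilon> + 1) * (pi * (3 * \<epsilon>)\<^sup>2)"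
    using measure_finite_UN_cball_le[OF T(1), of "3 * \<epsilon>" "polar_curve f"] T(2) \<epsilon>
    by (smt (verit) mult_right_mono pi_ge_zero zero_le_power2 mult_nonneg_nonneg)
  also have "measure lebesgue ?B = pi * ((m + 2) * \<epsilon>)\<^sup>2"
    using \<epsilon> \<open>0 < m\<close> by (intro measure_ball_plane) simp
  finally show ?thesis by simp
qed

text \<open>Both bounds are \<open>\<epsilon>\<close> times a factor that is constant or logarithmic
  to leading order; the logarithm of such a factor is negligible against
  \<open>ln \<epsilon>\<close>.\<close>

lemma ln_ratio_squeeze:
  assumes "0 < c" "0 < M"
    and lower: "\<forall>\<^sub>F \<epsilon> in at_right 0. c * \<epsilon> \<le> A \<epsilon>"
    and upper: "\<forall>\<^sub>F \<epsilon> in at_right 0.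
      A \<epsilon> \<le> (M * ln (1 / \<epsilon>) / \<epsilon> + 1) * (pi * (3 * \<epsilon>)\<^sup>2) + pi * (K * \<epsilon>)\<^sup>2"
  shows "((\<lambda>\<epsilon>. ln (A \<epsilon>) / ln \<epsilon>) \<longlongrightarrow> 1) (at_right (0::real))"
proof (rule tendsto_sandwich)
  let ?U = "\<lambda>\<epsilon>. (M * ln (1 / \<epsilon>) / \<epsilon> + 1) * (pi * (3 * \<epsilon>)\<^sup>2) + pi * (K * \<epsilon>)\<^sup>2"
  have small: "\<forall>\<^sub>F \<epsilon> in at_right (0::real). 0 < \<epsilon> \<and> \<epsilon> < 1"
    using eventually_at_right_real[of 0 "1::real"] by simp
  \<comment> \<open>As \<open>ln \<epsilon>\<close> is negative, division reverses the order: the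
    upper bound on \<open>A\<close> gives the lower function of the sandwich. The lower bound on
    \<open>A\<close> supplies the positivity that monotonicity of \<open>ln\<close>
    requires.\<close>
  show "\<forall>\<^sub>F \<epsilon> in at_right 0. ln (?U \<epsilon>) / ln \<epsilon> \<le> ln (A \<epsilon>) / ln \<epsilon>"
    using small lower upper
  proof eventually_elim
    case (elim \<epsilon>)
    then have "0 < A \<epsilon>" using assms(1) by (smt (verit) mult_pos_pos)
    then show ?case using elim by (intro divide_right_mono_neg ln_mono) auto
  qed
  show "\<forall>\<^sub>F \<epsilon> in at_right 0. ln (A \<epsilon>) / ln \<epsilon> \<le> ln (c * \<epsilon>) / ln \<epsilon>"
    using small lower
  proof eventually_elim
    case (elim \<epsilon>)
    then have "0 < c * \<epsilon>" using assms(1) by simp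
    then show ?case using elim by (intro divide_right_mono_neg ln_mono) auto
  qed
  show "((\<lambda>\<epsilon>. ln (c * \<epsilon>) / ln \<epsilon>) \<longlongrightarrow> 1) (at_right 0)"
    using assms(1) by real_asymp
  \<comment> \<open>This is \<open>?U\<close> expanded, so that the leading term
    \<open>\<epsilon> * ln (1 / \<epsilon>)\<close> with its positive coefficient is
    explicit.\<close>
  have "((\<lambda>\<epsilon>. ln (9 * pi * M * (ln (1 / \<epsilon>) * \<epsilon>) + (9 * pi + pi * K\<^sup>2) * \<epsilon>\<^sup>2) / ln \<epsilon>) \<longlongrightarrow> 1) (at_right 0)"
    using assms(2) by real_asymp
  moreover have "\<forall>\<^sub>F \<epsilon> in at_right (0::real).
      9 * pi * M * (ln (1 / \<epsilon>) * \<epsilon>) + (9 * pi + pi * K\<^sup>2) * \<epsilon>\<^sup>2 = ?U \<epsilon>"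
    using small by eventually_elim (simp add: field_simps power2_eq_square)
  ultimately show "((\<lambda>\<epsilon>. ln (?U \<epsilon>) / ln \<epsilon>) \<longlongrightarrow> 1) (at_right 0)"
    by (elim Lim_transform_eventually) (auto elim!: eventually_mono)
qed

theorem theorem1p4:
  fixes f :: "real \<Rightarrow> real" and \<phi>\<^sub>1 m M :: real
  assumes "\<phi>\<^sub>1 > 1"
    and "continuous_on {\<phi>\<^sub>1..} f"
    and "(f \<longlongrightarrow> 0) at_top"
    and "m > 0" and "M > 0"
    and "\<And>\<phi>. \<phi> \<ge> \<phi>\<^sub>1 \<Longrightarrow> 0 < f \<phi> \<and> f \<phi> \<le> m * inverse \<phi>"
    and "\<And>\<phi>. \<phi> \<ge> \<phi>\<^sub>1 \<Longrightarrow> 0 < f \<phi> - f (\<phi> + 2 * pi)"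
    and "\<And>\<phi>. \<phi> \<ge> \<phi>\<^sub>1 \<Longrightarrow> curve_length (polar_curve f) {\<phi>\<^sub>1..<\<phi>} \<le> ennreal (M * ln \<phi>)"
  shows "has_box_dim (polar_curve f ` {\<phi>\<^sub>1..}) 1"
proof -
  let ?G = "polar_curve f ` {\<phi>\<^sub>1..}"
  let ?p = "polar_curve f \<phi>\<^sub>1" and ?q = "polar_curve f (\<phi>\<^sub>1 + 2 * pi)"
  have bdd: "bounded ?G"
  proof (rule boundedI)
    fix q assume "q \<in> ?G"
    then obtain s where s: "s \<ge> \<phi>\<^sub>1" "q = polar_curve f s" by auto
    have "m * inverse s \<le> m * inverse 1"
      using s assms(1,4) by (intro mult_left_mono le_imp_inverse_le) auto
    then show "norm q \<le> m"
      using assms(6)[OF s(1)] s(2) by (simp add: norm_polar_curve)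
  qed
  have conn: "connected ?G"
    unfolding polar_curve_def
    by (intro connected_continuous_image continuous_intros assms(2)) auto
  \<comment> \<open>One full turn strictly decreases the radius, so the curve contains two distinct
    points and the lower bound has a positive constant.\<close>
  have "norm ?p \<noteq> norm ?q"
    using assms(6)[of \<phi>\<^sub>1] assms(6)[of "\<phi>\<^sub>1 + 2 * pi"] assms(7)[of \<phi>\<^sub>1]
    by (simp add: norm_polar_curve)
  then have "?p \<noteq> ?q" by metis
  then have pos: "0 < dist ?p ?q * pi / 2" by simp
  have lower: "\<forall>\<^sub>F \<epsilon> in at_right 0. dist ?p ?q * pi / 2 * \<epsilon> \<le> measure lebesgue (parallel_set ?G \<epsilon>)"
    using eventually_at_right_less[of 0]
    by eventually_elim (intro connected_parallel_set_ge conn bdd, auto)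
  have "\<forall>\<^sub>F \<epsilon> in at_right 0. 0 < \<epsilon> \<and> \<epsilon> < 1 / \<phi>\<^sub>1"
    using eventually_at_right_real[of 0 "1 / \<phi>\<^sub>1"] assms(1) by simp
  then have upper: "\<forall>\<^sub>F \<epsilon> in at_right 0. measure lebesgue (parallel_set ?G \<epsilon>)
      \<le> (M * ln (1 / \<epsilon>) / \<epsilon> + 1) * (pi * (3 * \<epsilon>)\<^sup>2) + pi * ((m + 2) * \<epsilon>)\<^sup>2"
  proof eventually_elim
    case (elim \<epsilon>)
    \<comment> \<open>With \<open>\<epsilon>\<close> below \<open>1 / \<phi>\<^sub>1\<close> the cut
      angle \<open>1 / \<epsilon>\<close> is in the range where the length hypothesis applies, and
      its logarithm is nonnegative.\<close>
    then have le: "\<phi>\<^sub>1 \<le> 1 / \<epsilon>" using assms(1) by (simp add: field_simps)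
    then have "0 \<le> M * ln (1 / \<epsilon>)"
      using assms(1,5) by (intro mult_nonneg_nonneg ln_ge_zero) auto
    moreover have "\<bar>f \<phi>\<bar> \<le> m * inverse \<phi>" if "\<phi> \<ge> \<phi>\<^sub>1" for \<phi>
      using assms(6)[OF that] by simp
    ultimately show ?case
      using assms(1,4) assms(8)[OF le] elim bdd by (intro spiral_parallel_set_le) auto
  qed
  show ?thesis
    unfolding has_box_dim_def using bdd ln_ratio_squeeze[OF pos assms(5) lower upper]
    by (auto intro!: exI[of _ 1])
qed

end
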